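(* Let $r,c>1$ be integers and let $A$ be a binary, equireplicate $r\times c$ array on $v$ symbols, with replication number $e$. (1) If $2c-v = \frac{c(e-1)}{r-1}$, then any two distinct rows of $A$ have exactly $\frac{c(e-1)}{r-1}$ common symbols; in particular $A$ has constant row-row intersection size (property RR). (2) If $2r-v = \frac{r(e-1)}{c-1}$, then any two distinct columns of $A$ have exactly $\frac{r(e-1)}{c-1}$ common symbols; in particular $A$ has constant column-column intersection size (property CC).
   Context: An array is binary if no symbol occurs more than once in any row or in any column; it is equireplicate with replication number $e$ if each of the $v$ symbols occurs exactly $e$ times in the array (so $ev=rc$). Rows and columns are identified with the sets of symbols they contain. Property RR: any two distinct rows have the same number $\lambda_{rr}$ of common symbols. Property CC: any two distinct columns have the same number $\lambda_{cc}$ of common symbols. *)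

theory Defs
  imports Complex_Main
begin

text \<open>
  An \<open>r \<times> c\<close> array is a function \<open>A\<close>, where \<open>A i j\<close> is the entry in row \<open>i\<close> and
  column \<open>j\<close> for \<open>i < r\<close> and \<open>j < c\<close>; values at other indices are irrelevant.
  The array comes with a symbol set \<open>S\<close>, which a priori may contain symbols that do not occur.
\<close>

type_synonym 'a array = "nat \<Rightarrow> nat \<Rightarrow> 'a"

definition array_on :: "nat \<Rightarrow> nat \<Rightarrow> 'a set \<Rightarrow> 'a array \<Rightarrow> bool" where
  "array_on r c S A \<longleftrightarrow> finite S \<and> (\<forall>i<r. \<forall>j<c. A i j \<in> S)"

definition binary_array :: "nat \<Rightarrow> nat \<Rightarrow> 'a array \<Rightarrow> bool" where
  "binary_array r c A \<longleftrightarrow>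
     (\<forall>i<r. inj_on (\<lambda>j. A i j) {..<c}) \<and> (\<forall>j<c. inj_on (\<lambda>i. A i j) {..<r})"

definition equireplicate :: "nat \<Rightarrow> nat \<Rightarrow> 'a set \<Rightarrow> nat \<Rightarrow> 'a array \<Rightarrow> bool" where
  "equireplicate r c S e A \<longleftrightarrow>
     (\<forall>s\<in>S. card {(i, j). i < r \<and> j < c \<and> A i j = s} = e)"

definition row_symbols :: "nat \<Rightarrow> 'a array \<Rightarrow> nat \<Rightarrow> 'a set" where
  "row_symbols c A i = (\<lambda>j. A i j) ` {..<c}"

definition column_symbols :: "nat \<Rightarrow> 'a array \<Rightarrow> nat \<Rightarrow> 'a set" where
  "column_symbols r A j = (\<lambda>i. A i j) ` {..<r}"

text \<open>
  Distinctness of rows and columns refers to their indices, so two rows with equal symbol sets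
  still count as two distinct rows.
\<close>

definition property_RR :: "nat \<Rightarrow> nat \<Rightarrow> 'a array \<Rightarrow> bool" where
  "property_RR r c A \<longleftrightarrow>
     (\<exists>l. \<forall>i<r. \<forall>i'<r. i \<noteq> i' \<longrightarrow> card (row_symbols c A i \<inter> row_symbols c A i') = l)"

definition property_CC :: "nat \<Rightarrow> nat \<Rightarrow> 'a array \<Rightarrow> bool" where
  "property_CC r c A \<longleftrightarrow>
     (\<exists>l. \<forall>j<c. \<forall>j'<c. j \<noteq> j' \<longrightarrow> card (column_symbols r A j \<inter> column_symbols r A j') = l)"

end

theory Submission
  imports Defs
begin

text \<open>
  Two rows of \<open>c\<close> symbols out of \<open>v\<close> share at least \<open>2 c - v\<close> symbols. On the other hand, each of the
  \<open>c\<close> symbols of a fixed row lies in exactly \<open>e - 1\<close> of the other \<open>r - 1\<close> rows, so the fixed row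
  shares \<open>c (e - 1) / (r - 1)\<close> symbols with another row on average. If the minimum equals the average,
  all intersection sizes are equal. Columns are the rows of the transposed array.
\<close>

text \<open>The sets form an indexed family, so that equal sets at different indices count
  separately, as rows with equal symbol sets must.\<close>

lemma card_Int_eq_average:
  fixes R :: "'i \<Rightarrow> 'a set" and c e :: nat
  assumes "finite I" and "card I > 1" and "finite S"
    and sub: "\<And>k. k \<in> I \<Longrightarrow> R k \<subseteq> S"
    and card_R: "\<And>k. k \<in> I \<Longrightarrow> card (R k) = c"
    and card_occ: "\<And>s. s \<in> S \<Longrightarrow> card {k \<in> I. s \<in> R k} = e"
    and tight: "2 * real c - real (card S) = real c * (real e - 1) / (real (card I) - 1)"
    and i: "i \<in> I" and i': "i' \<in> I" "i \<noteq> i'"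
  shows "real (card (R i \<inter> R i')) = real c * (real e - 1) / (real (card I) - 1)"
proof -
  have fin: "finite (R k)" if "k \<in> I" for k
    using sub[OF that] \<open>finite S\<close> by (rule finite_subset)
  have lower: "2 * real c - real (card S) \<le> real (card (R i \<inter> R k))" if "k \<in> I" for k
  proof -
    have "card (R i) + card (R k) = card (R i \<union> R k) + card (R i \<inter> R k)"
      using fin i that by (intro card_Un_Int) auto
    moreover have "card (R i \<union> R k) \<le> card S"
      using sub i that \<open>finite S\<close> by (intro card_mono) auto
    ultimately show ?thesis using card_R i that by simp
  qed
  \<comment> \<open>One of the \<open>e\<close> indices whose sets contain \<open>s\<close> is
    \<open>i\<close> itself. The bound \<open>e \<ge> 1\<close> is kept because \<open>e - 1\<close>
    is truncated subtraction, unlike \<open>real e - 1\<close> in the claim.\<close>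
  have "card {k \<in> I - {i}. s \<in> R k} = e - 1" and e_pos: "e \<ge> 1" if "s \<in> R i" for s
  proof -
    have "s \<in> S" using sub i that by blast
    then have *: "card {k \<in> I. s \<in> R k} = e" by (rule card_occ)
    have mem: "i \<in> {k \<in> I. s \<in> R k}" and "finite {k \<in> I. s \<in> R k}"
      using i that \<open>finite I\<close> by auto
    then show "e \<ge> 1" using * by (metis One_nat_def Suc_leI card_gt_0_iff empty_iff)
    have "{k \<in> I - {i}. s \<in> R k} = {k \<in> I. s \<in> R k} - {i}" by auto
    then show "card {k \<in> I - {i}. s \<in> R k} = e - 1" using mem * by simp
  qed
  \<comment> \<open>Double counting of the pairs of an index \<open>k\<close> other than
    \<open>i\<close> and a symbol \<open>s\<close> common to \<open>R i\<close> and
    \<open>R k\<close>.\<close>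
  then have "(\<Sum>k\<in>I - {i}. card {s \<in> R i. s \<in> R k}) = (\<Sum>s\<in>R i. e - 1)"
    using \<open>finite I\<close> fin i by (intro sum_multicount_gen) auto
  then have "(\<Sum>k\<in>I - {i}. card (R i \<inter> R k)) = c * (e - 1)"
    using card_R i by (simp add: Int_def)
  then have "(\<Sum>k\<in>I - {i}. real (card (R i \<inter> R k))) = real (c * (e - 1))"
    by (metis of_nat_sum)
  also have "\<dots> = real c * (real e - 1)"
  \<comment> \<open>If \<open>R i\<close> is empty, then \<open>c = 0\<close> and both sides vanish;
    otherwise any symbol of \<open>R i\<close> gives \<open>e \<ge> 1\<close>, and nothing is
    truncated.\<close>
  proof (cases "R i = {}")
    case True
    then show ?thesis using card_R[OF i] by simp
  next
    case False
    then have "e \<ge> 1" using e_pos by blast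
    then show ?thesis by simp
  qed
  \<comment> \<open>By \<open>tight\<close>, each of the \<open>card I - 1\<close> equal terms is
    the average; the denominator is nonzero and cancels.\<close>
  also have "\<dots> = (\<Sum>k\<in>I - {i}. 2 * real c - real (card S))"
    using \<open>finite I\<close> \<open>card I > 1\<close> i unfolding tight by simp
  finally have "(\<Sum>k\<in>I - {i}. 2 * real c - real (card S)) = (\<Sum>k\<in>I - {i}. real (card (R i \<inter> R k)))"
    by (rule sym)
  \<comment> \<open>By \<open>lower\<close>, the left sum is termwise at most the right one, so
    equal sums force equality in every term.\<close>
  then have "2 * real c - real (card S) = real (card (R i \<inter> R i'))"
    by (rule sum_mono_inv) (use lower i' \<open>finite I\<close> in auto)
  then show ?thesis using tight by simp
qed

lemma card_row_symbols_Int: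
  assumes "r > 1" and "array_on r c S A" and "binary_array r c A" and "equireplicate r c S e A"
    and "2 * real c - real (card S) = real c * (real e - 1) / (real r - 1)"
    and "i < r" and "i' < r" and "i \<noteq> i'"
  shows "real (card (row_symbols c A i \<inter> row_symbols c A i')) = real c * (real e - 1) / (real r - 1)"
proof -
  have inj: "inj_on (A k) {..<c}" if "k < r" for k
    using assms(3) that by (simp add: binary_array_def)
  have "card {k \<in> {..<r}. s \<in> row_symbols c A k} = e" if "s \<in> S" for s
  proof -
    \<comment> \<open>A symbol occurs at most once in each row, so projecting its cells to their row
      indices turns the number of occurrences into a number of rows.\<close>
    have "inj_on fst {(k, j). k < r \<and> j < c \<and> A k j = s}"
      using inj unfolding inj_on_def by fastforce
    moreover have "fst ` {(k, j). k < r \<and> j < c \<and> A k j = s} = {k \<in> {..<r}. s \<in> row_symbols c A k}"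
      unfolding row_symbols_def image_def by auto
    moreover have "card {(k, j). k < r \<and> j < c \<and> A k j = s} = e"
      using assms(4) that unfolding equireplicate_def by blast
    ultimately show ?thesis
      using card_image by fastforce
  qed
  moreover have "row_symbols c A k \<subseteq> S" if "k < r" for k
    using assms(2) that by (auto simp: array_on_def row_symbols_def)
  moreover have "card (row_symbols c A k) = c" if "k < r" for k
    using inj[OF that] by (simp add: row_symbols_def card_image)
  moreover have "finite S"
    using assms(2) by (simp add: array_on_def)
  ultimately show ?thesis
    using card_Int_eq_average[of "{..<r}" S "row_symbols c A" c e i i'] assms(1,5-8) by simp
qed

lemma array_on_transpose: "array_on r c S A \<Longrightarrow> array_on c r S (\<lambda>i j. A j i)"
  by (simp add: array_on_def)

lemma binary_array_transpose: "binary_array r c A \<Longrightarrow> binary_array c r (\<lambda>i j. A j i)"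
  by (simp add: binary_array_def)

lemma equireplicate_transpose:
  assumes "equireplicate r c S e A"
  shows "equireplicate c r S e (\<lambda>i j. A j i)"
proof -
  have "{(i, j). i < c \<and> j < r \<and> A j i = s} = prod.swap ` {(i, j). i < r \<and> j < c \<and> A i j = s}" for s
    by force
  then show ?thesis
    using assms by (simp add: equireplicate_def card_image)
qed

lemma row_symbols_transpose: "row_symbols r (\<lambda>i j. A j i) = column_symbols r A"
  by (simp add: fun_eq_iff row_symbols_def column_symbols_def)

theorem proposition3p2:
  fixes r c v e :: nat and S :: "'a set" and A :: "'a array"
  assumes "r > 1" and "c > 1"
    and "array_on r c S A" and "card S = v"
    and "binary_array r c A" and "equireplicate r c S e A"
  shows "(2 * real c - real v = real c * (real e - 1) / (real r - 1) \<longrightarrow>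
            (\<forall>i<r. \<forall>i'<r. i \<noteq> i' \<longrightarrow>
               real (card (row_symbols c A i \<inter> row_symbols c A i'))
                 = real c * (real e - 1) / (real r - 1)) \<and>
            property_RR r c A) \<and>
         (2 * real r - real v = real r * (real e - 1) / (real c - 1) \<longrightarrow>
            (\<forall>j<c. \<forall>j'<c. j \<noteq> j' \<longrightarrow>
               real (card (column_symbols r A j \<inter> column_symbols r A j'))
                 = real r * (real e - 1) / (real c - 1)) \<and>
            property_CC r c A)"
proof -
  have const: "\<exists>l. \<forall>i<n. \<forall>i'<n. i \<noteq> i' \<longrightarrow> f i i' = l"
    if "\<forall>i<n. \<forall>i'<n. i \<noteq> i' \<longrightarrow> real (f i i') = x" for n x and f :: "nat \<Rightarrow> nat \<Rightarrow> nat"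
  proof (intro exI allI impI)
    \<comment> \<open>The common size must be a natural number, while \<open>x\<close> is a real
      fraction. A pair of distinct indices shows that \<open>x\<close> is a natural number, which
      the floor recovers; without such a pair any witness will do.\<close>
    show "f i i' = nat \<lfloor>x\<rfloor>" if "i < n" "i' < n" "i \<noteq> i'" for i i'
      using \<open>\<forall>i<n. _\<close> that by (metis floor_of_nat nat_int)
  qed
  have rows: "\<forall>i<r. \<forall>i'<r. i \<noteq> i' \<longrightarrow> real (card (row_symbols c A i \<inter> row_symbols c A i'))
      = real c * (real e - 1) / (real r - 1)"
    if "2 * real c - real v = real c * (real e - 1) / (real r - 1)"
    using card_row_symbols_Int assms that by blast
  have columns: "\<forall>j<c. \<forall>j'<c. j \<noteq> j' \<longrightarrow> real (card (column_symbols r A j \<inter> column_symbols r A j'))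
      = real r * (real e - 1) / (real c - 1)"
    if "2 * real r - real v = real r * (real e - 1) / (real c - 1)"
    \<comment> \<open>Transposing exchanges \<open>r\<close> and \<open>c\<close> but keeps
      \<open>S\<close> and \<open>e\<close>, so the row result becomes the column statement.\<close>
    using card_row_symbols_Int[OF \<open>c > 1\<close> array_on_transpose[OF assms(3)]
        binary_array_transpose[OF assms(5)] equireplicate_transpose[OF assms(6)]] assms(4) that
    by (simp add: row_symbols_transpose)
  show ?thesis
    unfolding property_RR_def property_CC_def
    by (intro conjI impI; (rule rows columns const[OF rows] const[OF columns], assumption))
qed

end
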